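(* Let $G=(V,E)$ be a finite connected simple undirected graph and let $\rho$ be a choice function on $V$. Then there exists a graph $cl_{\rho}(G)$ such that $cl_\rho(G)$ contains no N2-eligible vertex, $G$ is a spanning subgraph of $cl_{\rho}(G)$, and $c(cl_{\rho}(G))=c(G)$.
   Context: Graphs are finite, simple, undirected and connected; an edge $\{x,y\}$ is written $xy$. For a graph $G=(V,E)$ and $x\in V$: $N(x)=\{y: xy\in E\}$, $N[x]=N(x)\cup\{x\}$; for $X\subseteq V$, $N[X]=\bigcup_{x\in X}N[x]$, $N(X)=N[X]\setminus X$, and $E(X)=\{xy\in E: x,y\in X\}$, $\sigma(X)=|E(X)|$. Two vertices $x,y$ are neighborhood-equivalent if $N[x]=N[y]$; $\bar x$ denotes the equivalence class of $x$. A vertex $x$ is simplicial if $N[x]$ is a clique. Define $\chi_2(x)=\min(\sigma(N(\bar x)),2)$, i.e. $\chi_2(x)=0$ if $\sigma(N(\bar x))=0$, $1$ if $\sigma(N(\bar x))=1$, and $2$ otherwise. A vertex $x$ of $G$ is N2-eligible (in $G$) if $x$ is non-simplicial and $|\bar x|\ge |N(\bar x)|-\chi_2(x)$. A choice function on $V$ is a function $\rho:\mathcal P(V)\to V$ with $\rho(X)\in X$ for every non-empty $X\subseteq V$. The circumference $c(G)$ is the length of a longest cycle of $G$ (cycles have length at least $3$), with $c(G)=0$ if $G$ has no cycle. $G$ is a spanning subgraph of $H$ if they have the same vertex set and every edge of $G$ is an edge of $H$. *)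

theory Defs
  imports "Graph_Theory.Digraph_Component" "Graph_Theory.Pair_Digraph" "HOL-Library.FuncSet"
begin

text \<open>
  A finite simple undirected graph is a \<^emph>\<open>pair_graph\<close>: each edge $xy$ is represented by the
  two arcs $(x,y)$ and $(y,x)$.
\<close>

definition nbhd :: "'a pair_pre_digraph \<Rightarrow> 'a \<Rightarrow> 'a set" where
  "nbhd G x = {y. (x, y) \<in> parcs G}"

definition closed_nbhd :: "'a pair_pre_digraph \<Rightarrow> 'a \<Rightarrow> 'a set" where
  "closed_nbhd G x = nbhd G x \<union> {x}"

definition closed_nbhd_set :: "'a pair_pre_digraph \<Rightarrow> 'a set \<Rightarrow> 'a set" where
  "closed_nbhd_set G X = (\<Union>x\<in>X. closed_nbhd G x)"

definition nbhd_set :: "'a pair_pre_digraph \<Rightarrow> 'a set \<Rightarrow> 'a set" where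
  "nbhd_set G X = closed_nbhd_set G X - X"

text \<open>Unordered pairs, so that the two arcs of an edge are counted once.\<close>

definition edges_within :: "'a pair_pre_digraph \<Rightarrow> 'a set \<Rightarrow> 'a set set" where
  "edges_within G X = {{x, y} | x y. (x, y) \<in> parcs G \<and> x \<in> X \<and> y \<in> X}"

definition sigma :: "'a pair_pre_digraph \<Rightarrow> 'a set \<Rightarrow> nat" where
  "sigma G X = card (edges_within G X)"

definition nbhd_class :: "'a pair_pre_digraph \<Rightarrow> 'a \<Rightarrow> 'a set" where
  "nbhd_class G x = {y \<in> pverts G. closed_nbhd G x = closed_nbhd G y}"

definition clique :: "'a pair_pre_digraph \<Rightarrow> 'a set \<Rightarrow> bool" where
  "clique G X \<longleftrightarrow> X \<subseteq> pverts G \<and> (\<forall>x\<in>X. \<forall>y\<in>X. x \<noteq> y \<longrightarrow> (x, y) \<in> parcs G)"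

definition simplicial :: "'a pair_pre_digraph \<Rightarrow> 'a \<Rightarrow> bool" where
  "simplicial G x \<longleftrightarrow> clique G (closed_nbhd G x)"

definition chi2 :: "'a pair_pre_digraph \<Rightarrow> 'a \<Rightarrow> nat" where
  "chi2 G x = min (sigma G (nbhd_set G (nbhd_class G x))) 2"

definition N2_eligible :: "'a pair_pre_digraph \<Rightarrow> 'a \<Rightarrow> bool" where
  "N2_eligible G x \<longleftrightarrow>
     x \<in> pverts G \<and> \<not> simplicial G x \<and>
     int (card (nbhd_class G x)) \<ge> int (card (nbhd_set G (nbhd_class G x))) - int (chi2 G x)"

definition choice_function :: "'a set \<Rightarrow> ('a set \<Rightarrow> 'a) \<Rightarrow> bool" where
  "choice_function V \<rho> \<longleftrightarrow> \<rho> \<in> Pow V \<rightarrow> V \<and> (\<forall>X. X \<subseteq> V \<and> X \<noteq> {} \<longrightarrow> \<rho> X \<in> X)"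

text \<open>
  A cycle is given by its list of arcs. The length condition excludes the closed walks $x, y, x$
  along a single edge, which are directed cycles of the symmetric digraph.
\<close>

definition undirected_cycle :: "'a pair_pre_digraph \<Rightarrow> ('a \<times> 'a) list \<Rightarrow> bool" where
  "undirected_cycle G p \<longleftrightarrow> pre_digraph.cycle (with_proj G) p \<and> 3 \<le> length p"

definition circumference :: "'a pair_pre_digraph \<Rightarrow> nat" where
  "circumference G =
     (if \<exists>p. undirected_cycle G p then Max {length p | p. undirected_cycle G p} else 0)"

end

theory Submission
  imports Defs
begin

text \<open>
  Among the graphs on the vertex set of \<open>G\<close> that contain \<open>G\<close> and have the same circumference,
  take one, \<open>H\<close>, with as many edges as possible. If \<open>H\<close> had an N2-eligible vertex \<open>x\<close>, then two
  neighbours \<open>u\<close>, \<open>v\<close> of \<open>x\<close> would be non-adjacent, and adding the edge \<open>uv\<close> would contradict the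
  maximality of \<open>H\<close>, provided that this edge does not raise the circumference. So everything rests
  on this proviso, \<open>circumference_add_edge\<close>. Maximality allows a single new edge to be considered
  at a time, so that a new cycle differs from a path of \<open>H\<close> in one edge only.

  Write \<open>A\<close> for the equivalence class of \<open>x\<close> and \<open>N\<close> for its neighbourhood, so that each vertex of
  \<open>A\<close> has exactly the other vertices of \<open>A \<union> N\<close> as neighbours. A cycle through the new edge \<open>uv\<close>
  leaves a path \<open>P\<close> of \<open>H\<close> from \<open>u\<close> to \<open>v\<close> on the same vertices, both ends lying in \<open>N\<close>. The lemma
  \<open>twin_path_to_cycle\<close> turns \<open>P\<close> into a cycle of \<open>H\<close> that is at least as long. If \<open>P\<close> misses a
  vertex of \<open>A\<close>, that vertex closes \<open>P\<close> to a cycle. If two vertices of \<open>A\<close> are consecutive on \<open>P\<close>,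
  cut \<open>P\<close> between them and reconnect its parts crosswise at the ends of \<open>P\<close>.

  Otherwise deleting \<open>A\<close> cuts \<open>P\<close> into \<open>|A| + 1\<close> fragments whose ends lie in \<open>N\<close>. As \<open>A\<close> is
  completely joined to \<open>N\<close>, any \<open>|A|\<close> such fragments can be threaded, with the vertices of \<open>A\<close>
  between them, to a cycle (\<open>fragments_cycle\<close>); so there is exactly one fragment too many, and it is
  enough to join two of them by an edge of \<open>N\<close>. If \<open>s\<close> of the fragments are single vertices and
  \<open>t\<close> are longer, their ends are \<open>s + 2 t = |A| + 1 + t\<close> distinct elements of \<open>N\<close>, and eligibility
  gives \<open>t \<le> \<chi>\<^sub>2(x) - 1 \<le> 1\<close>. For \<open>t = 0\<close>, any edge inside \<open>N\<close> will do, even one with an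
  end off \<open>P\<close>: then the vertices of \<open>N\<close> are interchangeable. For \<open>t = 1\<close>, the ends of the fragments
  exhaust \<open>N\<close>, and an edge inside \<open>N\<close> is useful unless it joins the two ends of the long fragment;
  there are two edges, so one of them is useful.
\<close>

section \<open>Cycles as lists of vertices\<close>

definition vertex_cycle :: "('a \<Rightarrow> 'a \<Rightarrow> bool) \<Rightarrow> 'a list \<Rightarrow> bool" where
  "vertex_cycle R vs \<longleftrightarrow>
     3 \<le> length vs \<and> distinct vs \<and> successively R vs \<and> R (last vs) (hd vs)"

lemma vertex_cycle_rotate:
  assumes "vertex_cycle R (xs @ ys)"
  shows "vertex_cycle R (ys @ xs)"
  using assms
  by (cases "xs = []"; cases "ys = []") (auto simp: vertex_cycle_def successively_append_iff)

lemma not_successively_obtain: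
  assumes "\<not> successively R vs"
  obtains xs x y ys where "vs = xs @ x # y # ys" "\<not> R x y"
proof -
  have "\<exists>xs x y ys. vs = xs @ x # y # ys \<and> \<not> R x y"
    using assms
  proof (induction vs rule: induct_list012)
    case (3 a b zs)
    show ?case
    proof (cases "R a b")
      case True
      with 3 obtain xs x y ys where "b # zs = xs @ x # y # ys" "\<not> R x y" by auto
      then show ?thesis by (intro exI[of _ "a # xs"]) auto
    qed (blast intro: append_Nil[symmetric])
  qed auto
  then show ?thesis using that by blast
qed

text \<open>A cycle that uses the new edge \<open>uv\<close> can be rotated so that this edge closes it. The new edge
  cannot occur a second time, because the vertices are distinct and there are at least three.\<close>

lemma vertex_cycle_extra_edge:
  assumes cyc: "vertex_cycle R' vs"
    and extra: "\<And>x y. R' x y \<Longrightarrow> R x y \<or> {x, y} = {u, v}"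
    and new: "\<not> vertex_cycle R vs"
  obtains P where "length P = length vs" "distinct P" "successively R P"
    "{hd P, last P} = {u, v}"
proof -
  obtain ws where ws: "vertex_cycle R' ws" "\<not> R (last ws) (hd ws)" "length ws = length vs"
  proof (cases "R (last vs) (hd vs)")
    case False
    with cyc that show ?thesis by blast
  next
    case True
    with cyc new have "\<not> successively R vs" by (auto simp: vertex_cycle_def)
    then obtain xs x y ys where vs: "vs = xs @ x # y # ys" "\<not> R x y"
      by (rule not_successively_obtain)
    with cyc have "vertex_cycle R' ((xs @ [x]) @ (y # ys))" by simp
    then have "vertex_cycle R' ((y # ys) @ (xs @ [x]))" by (rule vertex_cycle_rotate)
    with vs show ?thesis using that[of "(y # ys) @ (xs @ [x])"] by simp
  qed
  then have ends: "{last ws, hd ws} = {u, v}" using extra by (auto simp: vertex_cycle_def)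
  have "successively R ws"
  proof (rule ccontr)
    assume "\<not> successively R ws"
    then obtain xs x y ys where spl: "ws = xs @ x # y # ys" "\<not> R x y"
      by (rule not_successively_obtain)
    with ws(1) have "R' x y" by (auto simp: vertex_cycle_def successively_append_iff)
    with spl ends extra have "{x, y} = {last ws, hd ws}" by auto
    moreover have "distinct ws" "3 \<le> length ws" using ws(1) by (auto simp: vertex_cycle_def)
    ultimately show False unfolding spl(1)
      by (cases xs; cases ys rule: rev_cases) (auto simp: doubleton_eq_iff)
  qed
  with ws ends that[of ws] show ?thesis by (auto simp: vertex_cycle_def insert_commute)
qed

section \<open>Cutting a path at a set of twins and closing it up again\<close>

text \<open>A path is split into the fragments \<open>Qs\<close> with at least two vertices and the set \<open>S\<close> of
  one-vertex fragments. The two kinds are kept apart because a fragment from \<open>Qs\<close> uses up two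
  elements of \<open>N\<close> and one from \<open>S\<close> only one, and because the order of the fragments is
  irrelevant.\<close>

definition fragments ::
    "('a \<Rightarrow> 'a \<Rightarrow> bool) \<Rightarrow> 'a set \<Rightarrow> 'a set \<Rightarrow> 'a list list \<Rightarrow> 'a set \<Rightarrow> bool" where
  "fragments R N A Qs S \<longleftrightarrow>
     (\<forall>Q\<in>set Qs. 2 \<le> length Q \<and> successively R Q \<and> hd Q \<in> N \<and> last Q \<in> N) \<and>
     distinct (concat Qs) \<and> A \<inter> set (concat Qs) = {} \<and>
     finite S \<and> S \<subseteq> N \<and> S \<inter> set (concat Qs) = {}"

text \<open>Every vertex of \<open>A\<close> on the path is a cut point between two vertices of \<open>N\<close>, so each deletion
  raises the number of fragments by one and the new ends lie in \<open>N\<close>.\<close>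

lemma path_fragments:
  assumes "P \<noteq> []" "distinct P" "hd P \<in> N" "last P \<in> N" "A \<inter> N = {}"
    and "successively (\<lambda>x y. R x y \<and> (x \<in> A \<longrightarrow> y \<in> N) \<and> (y \<in> A \<longrightarrow> x \<in> N)) P"
  shows "\<exists>Qs S. fragments R N A Qs S \<and> set (concat Qs) \<union> S = set P - A \<and>
           length Qs + card S = Suc (card (A \<inter> set P))"
  using assms(1-4,6)
proof (induction P rule: length_induct)
  case (1 P)
  show ?case
  proof (cases "A \<inter> set P = {}")
    case True
    have succ: "successively R P" using "1.prems"(5) by (rule successively_mono) auto
    show ?thesis
    proof (cases "2 \<le> length P")
      case long: True
      show ?thesis
        by (rule exI[of _ "[P]"], rule exI[of _ "{}"])
          (use True long succ "1.prems" in \<open>auto simp: fragments_def\<close>)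
    next
      case False
      with "1.prems"(1) obtain p where "P = [p]" by (cases P; cases "tl P") auto
      with True "1.prems" show ?thesis
        by (intro exI[of _ "[]"] exI[of _ "{p}"]) (auto simp: fragments_def)
    qed
  next
    case False
    then have "\<exists>y\<in>set P. y \<in> A" by auto
    then obtain U y P' where P: "P = U @ y # P'" and y: "y \<in> A" and U: "\<forall>z\<in>set U. z \<notin> A"
      by (rule split_list_first_propE) 
    have "U \<noteq> []" "P' \<noteq> []" using "1.prems"(3,4) assms(5) y P by auto
    with "1.prems"(5) have ends: "last U \<in> N" "hd P' \<in> N"
      and suU: "successively (\<lambda>x y. R x y \<and> (x \<in> A \<longrightarrow> y \<in> N) \<and> (y \<in> A \<longrightarrow> x \<in> N)) U"
      and suP: "successively (\<lambda>x y. R x y \<and> (x \<in> A \<longrightarrow> y \<in> N) \<and> (y \<in> A \<longrightarrow> x \<in> N)) P'"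
      using y by (auto simp: P successively_append_iff successively_Cons)
    have RU: "successively R U" using suU by (rule successively_mono) auto
    have "length P' < length P" by (simp add: P)
    moreover have "distinct P'" "last P' \<in> N" using "1.prems"(2,4) \<open>P' \<noteq> []\<close> P by auto
    ultimately obtain Qs S where IH: "fragments R N A Qs S"
        "set (concat Qs) \<union> S = set P' - A" "length Qs + card S = Suc (card (A \<inter> set P'))"
      using "1.IH"[rule_format, of P'] ends(2) suP \<open>P' \<noteq> []\<close> by blast
    have "A \<inter> set P = insert y (A \<inter> set P')" using P y U by auto
    moreover have "y \<notin> set P'" using "1.prems"(2) P by auto
    ultimately have c: "card (A \<inter> set P) = Suc (card (A \<inter> set P'))" by simp
    have hdU: "hd U \<in> N" "distinct U" using "1.prems" \<open>U \<noteq> []\<close> P by auto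
    have disj: "set U \<inter> (set (concat Qs) \<union> S) = {}" "A \<inter> set U = {}"
      using "1.prems"(2) P U unfolding IH(2) by auto
    have cover: "set U \<union> (set (concat Qs) \<union> S) = set P - A"
      unfolding IH(2) using P y U by auto
    have fS: "finite S" using IH(1) by (auto simp: fragments_def)
    show ?thesis
    proof (cases "2 \<le> length U")
      case True
      have "fragments R N A (U # Qs) S"
        using True IH(1) hdU ends(1) disj RU
        unfolding fragments_def by (auto simp del: set_concat)
      then show ?thesis
        using IH(3) c cover by (intro exI[of _ "U # Qs"] exI[of _ S]) (auto simp del: set_concat)
    next
      case False
      with \<open>U \<noteq> []\<close> obtain p where p: "U = [p]" by (cases U; cases "tl U") auto
      then have "p \<notin> S" using disj by auto
      moreover have "fragments R N A Qs (insert p S)"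
        using IH(1) hdU disj p unfolding fragments_def by (auto simp del: set_concat)
      ultimately show ?thesis
        using IH(3) c cover p fS
        by (intro exI[of _ "Qs"] exI[of _ "insert p S"]) (auto simp del: set_concat)
    qed
  qed
qed

lemma fragments_ends_card:
  assumes "fragments R N A Qs S"
  shows "card (S \<union> (\<Union>Q\<in>set Qs. {hd Q, last Q})) = card S + 2 * length Qs"
  using assms
proof (induction Qs)
  case (Cons Q Qs)
  then have "fragments R N A Qs S" by (auto simp: fragments_def)
  then have IH: "card (S \<union> (\<Union>Q\<in>set Qs. {hd Q, last Q})) = card S + 2 * length Qs"
    by (rule Cons.IH)
  have Q: "2 \<le> length Q" "distinct Q" "set Q \<inter> (S \<union> set (concat Qs)) = {}"
    and ne: "\<forall>Q\<in>set Qs. Q \<noteq> []" and fS: "finite S"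
    using Cons.prems by (fastforce simp: fragments_def)+
  have "hd Q \<noteq> last Q" using Q(1,2) by (cases Q) auto
  then have c2: "card {hd Q, last Q} = 2" by simp
  have "{hd Q, last Q} \<subseteq> set Q" using Q(1) by (cases Q) auto
  moreover have "S \<union> (\<Union>Q\<in>set Qs. {hd Q, last Q}) \<subseteq> S \<union> set (concat Qs)"
    using ne by force
  ultimately have "{hd Q, last Q} \<inter> (S \<union> (\<Union>Q\<in>set Qs. {hd Q, last Q})) = {}"
    using Q(3) by blast
  moreover have "S \<union> (\<Union>Q\<in>set (Q # Qs). {hd Q, last Q}) =
      {hd Q, last Q} \<union> (S \<union> (\<Union>Q\<in>set Qs. {hd Q, last Q}))" by auto
  ultimately have "card (S \<union> (\<Union>Q\<in>set (Q # Qs). {hd Q, last Q})) =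
      card {hd Q, last Q} + card (S \<union> (\<Union>Q\<in>set Qs. {hd Q, last Q}))"
    using fS card_Un_disjoint[of "{hd Q, last Q}" "S \<union> (\<Union>Q\<in>set Qs. {hd Q, last Q})"] by simp
  then show ?case using IH c2 by simp
qed simp

text \<open>Each fragment is followed by a vertex of \<open>ys\<close>. The list starts in \<open>N\<close> and ends in
  \<open>ys\<close>, which is what closes it to a cycle.\<close>

lemma interleave_fragments:
  assumes "length Us = length ys" "Us \<noteq> []"
    and "\<forall>U\<in>set Us. U \<noteq> [] \<and> successively R U \<and> hd U \<in> N \<and> last U \<in> N"
    and "distinct (concat Us)" "distinct ys" "set ys \<inter> set (concat Us) = {}"
    and hub: "\<forall>y\<in>set ys. \<forall>z\<in>N. R y z \<and> R z y"
  shows "\<exists>vs. vs \<noteq> [] \<and> hd vs \<in> N \<and> last vs \<in> set ys \<and> distinct vs \<and> successively R vs \<and>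
           set vs = set (concat Us) \<union> set ys"
  using assms
proof (induction Us ys rule: list_induct2)
  case (Cons U Us y ys)
  show ?case
  proof (cases "Us = []")
    case True
    with Cons.prems Cons.hyps show ?thesis
      by (intro exI[of _ "U @ [y]"]) (auto simp: successively_append_iff)
  next
    case False
    moreover have "set ys \<inter> set (concat Us) = {}" using Cons.prems(5) by auto
    ultimately obtain vs where vs: "vs \<noteq> []" "hd vs \<in> N" "last vs \<in> set ys" "distinct vs"
        "successively R vs" "set vs = set (concat Us) \<union> set ys"
      using Cons by (auto simp del: set_concat)
    from Cons.prems vs show ?thesis
      by (intro exI[of _ "U @ y # vs"])
        (auto simp: successively_append_iff successively_Cons simp del: set_concat)
  qed
qed simp

lemma fragments_cycle:
  assumes frag: "fragments R N A Qs S"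
    and A: "finite A" "A \<inter> N = {}" "\<forall>y\<in>A. \<forall>z\<in>N. R y z \<and> R z y"
    and count: "length Qs + card S = card A" "A \<noteq> {}"
    and long: "3 \<le> length (concat Qs) + card S + card A"
  shows "\<exists>vs. vertex_cycle R vs \<and> length vs = length (concat Qs) + card S + card A"
proof -
  obtain ys where ys: "set ys = A" "distinct ys"
    using finite_distinct_list[OF A(1)] by blast
  have "finite S" using frag by (simp add: fragments_def)
  then obtain ss where ss: "set ss = S" "distinct ss"
    using finite_distinct_list by blast
  let ?Us = "Qs @ map (\<lambda>s. [s]) ss"
  have conc: "concat (map (\<lambda>s. [s]) ss) = ss" by (induction ss) auto
  have len: "length ?Us = length ys"
    using count ys ss by (simp add: distinct_card[symmetric])
  moreover have "?Us \<noteq> []" using len count(2) ys(1) by (metis length_0_conv set_empty)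
  moreover have "\<forall>U\<in>set ?Us. U \<noteq> [] \<and> successively R U \<and> hd U \<in> N \<and> last U \<in> N"
    using frag ss by (auto simp: fragments_def)
  moreover have "distinct (concat ?Us)"
    using frag ss by (auto simp: fragments_def conc simp del: set_concat)
  moreover have "set ys \<inter> set (concat ?Us) = {}"
    using frag ss ys A(2) by (auto simp: fragments_def conc simp del: set_concat)
  moreover have "\<forall>y\<in>set ys. \<forall>z\<in>N. R y z \<and> R z y" using A(3) ys by simp
  ultimately obtain vs where vs: "vs \<noteq> []" "hd vs \<in> N" "last vs \<in> set ys" "distinct vs"
      "successively R vs" "set vs = set (concat ?Us) \<union> set ys"
    using interleave_fragments[of ?Us ys R N] ys(2) by blast
  have "length vs = card (set (concat ?Us) \<union> set ys)"
    using vs(4,6) by (metis distinct_card)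
  also have "\<dots> = card (set (concat ?Us)) + card (set ys)"
    using \<open>set ys \<inter> set (concat ?Us) = {}\<close> by (intro card_Un_disjoint) auto
  also have "\<dots> = length (concat ?Us) + card A"
    using \<open>distinct (concat ?Us)\<close> ys by (simp only: distinct_card)
  also have "length (concat ?Us) = length (concat Qs) + card S"
    using ss by (simp add: conc distinct_card[symmetric])
  finally have "length vs = length (concat Qs) + card S + card A" .
  moreover have "R (last vs) (hd vs)" using vs A(3) ys by auto
  ultimately show ?thesis
    using vs(4,5) long unfolding vertex_cycle_def by (intro exI[of _ vs]) simp
qed

text \<open>The bound on \<open>card N\<close> is the numerical condition in the definition of an eligible vertex. It
  leaves room for at most one fragment with distinct ends, and it provides the edges inside \<open>N\<close> that
  make up for the one fragment too many.\<close>

lemma twin_path_to_cycle: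
  assumes sym: "\<And>x y. R x y \<Longrightarrow> R y x" and irrefl: "\<And>x. \<not> R x x"
    and fin: "finite A" "finite N" and disj: "A \<inter> N = {}" and ne: "A \<noteq> {}"
    and twins: "\<And>y z. y \<in> A \<Longrightarrow> R y z \<longleftrightarrow> z \<in> A \<union> N \<and> z \<noteq> y"
    and card: "card N \<le> card A + min (card {{x, y} | x y. R x y \<and> x \<in> N \<and> y \<in> N}) 2"
    and P: "3 \<le> length P" "distinct P" "successively R P" "hd P \<in> N" "last P \<in> N"
  shows "\<exists>vs. vertex_cycle R vs \<and> length P \<le> length vs"
proof -
  let ?F = "{{x, y} | x y. R x y \<and> x \<in> N \<and> y \<in> N}"
  have hub: "\<forall>y\<in>A. \<forall>z\<in>N. R y z \<and> R z y" using twins sym disj by blast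
  have Pne: "P \<noteq> []" using P(1) by auto
  consider (off) y where "y \<in> A" "y \<notin> set P"
    | (adj) "A \<subseteq> set P" "\<not> successively (\<lambda>x y. \<not> (x \<in> A \<and> y \<in> A)) P"
    | (alt) "A \<subseteq> set P" "successively (\<lambda>x y. \<not> (x \<in> A \<and> y \<in> A)) P" by blast
  then show ?thesis
  proof cases
    case off
    with P Pne hub have "vertex_cycle R (y # P)"
      by (auto simp: vertex_cycle_def successively_Cons)
    then show ?thesis by force
  next
    case adj
    obtain xs x y ys where spl: "P = xs @ x # y # ys" and xy: "x \<in> A" "y \<in> A"
      by (rule not_successively_obtain[OF adj(2)]) blast
    have "R x (last P)" "R y (hd P)" "R (hd P) y" using xy hub P by auto
    moreover have "xs \<noteq> []" "ys \<noteq> []" using spl xy P(4,5) disj by auto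
    moreover have "successively R (y # ys)" "successively R (xs @ [x])"
      using P(3) by (auto simp: spl successively_append_iff)
    then have "successively R (rev (y # ys))" "successively R (xs @ [x])"
      unfolding successively_rev by (auto elim: successively_mono dest: sym)
    \<comment> \<open>Delete the edge \<open>x y\<close> of the path and add the edges from \<open>x\<close> to its last vertex and from
      \<open>y\<close> to its first one.\<close>
    ultimately have "vertex_cycle R (xs @ x # rev ys @ [y])"
      using P(1,2) unfolding spl
      by (auto simp: vertex_cycle_def successively_append_iff successively_Cons hd_rev)
    then show ?thesis using spl by (intro exI[of _ "xs @ x # rev ys @ [y]"]) auto
  next
    case alt
    have "successively (\<lambda>x y. R x y \<and> \<not> (x \<in> A \<and> y \<in> A)) P"
      using P(3) alt(2) by (simp add: successively_conv_nth)
    then have "successively (\<lambda>x y. R x y \<and> (x \<in> A \<longrightarrow> y \<in> N) \<and> (y \<in> A \<longrightarrow> x \<in> N)) P"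
      by (rule successively_mono) (use twins sym in blast)
    then obtain Qs S where frag: "fragments R N A Qs S"
        and cover: "set (concat Qs) \<union> S = set P - A"
        and num: "length Qs + card S = Suc (card A)"
      using path_fragments[of P N A R] Pne P disj alt(1) by (auto simp: Int_absorb2)
    have fS: "finite S" "S \<subseteq> N" "S \<inter> set (concat Qs) = {}"
      using frag by (auto simp: fragments_def)
    have "length P = card (set P)" using P(2) by (simp add: distinct_card)
    also have "set P = A \<union> (set (concat Qs) \<union> S)" using cover alt(1) by auto
    also have "card \<dots> = card A + card (set (concat Qs) \<union> S)"
      by (rule card_Un_disjoint) (use cover fin fS in auto)
    also have "card (set (concat Qs) \<union> S) = length (concat Qs) + card S"
      using frag fS distinct_card[of "concat Qs"]
      by (subst card_Un_disjoint) (auto simp: fragments_def simp del: set_concat)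
    finally have lenP: "length P = card A + (length (concat Qs) + card S)" .
    let ?E = "S \<union> (\<Union>Q\<in>set Qs. {hd Q, last Q})"
    have EN: "?E \<subseteq> N" using frag by (auto simp: fragments_def)
    have cE: "card ?E = card S + 2 * length Qs" by (rule fragments_ends_card[OF frag])
    have le: "card S + 2 * length Qs \<le> card N" using card_mono[OF fin(2) EN] cE by simp
    then have Qs1: "length Qs \<le> 1" using card num by linarith
    show ?thesis
    proof (cases Qs)
      case Nil
      \<comment> \<open>All fragments are single vertices, so \<open>P\<close> has \<open>2 * card A + 1\<close> vertices. An edge \<open>wz\<close> and
        any \<open>card A - 1\<close> other elements of \<open>N\<close> give a cycle of this length, on or off \<open>P\<close>.\<close>
      then have "card ?F \<noteq> 0" using le card num by auto
      then have "?F \<noteq> {}" by (metis card.empty)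
      then obtain w z where wz: "R w z" "w \<in> N" "z \<in> N" by blast
      then have "w \<noteq> z" using irrefl by auto
      then have "card (N - {w, z}) = card N - 2" using wz by (simp add: card_Diff_subset)
      then have "card A - 1 \<le> card (N - {w, z})" using le Nil num by auto
      then obtain T where T: "T \<subseteq> N - {w, z}" "card T = card A - 1" "finite T"
        by (rule obtain_subset_with_card_n)
      have "fragments R N A [[w, z]] T"
        using T wz \<open>w \<noteq> z\<close> disj by (auto simp: fragments_def)
      moreover have "0 < card A" using ne fin by (simp add: card_gt_0_iff)
      moreover have "card S = Suc (card A)" using num Nil by simp
      ultimately have "\<exists>vs. vertex_cycle R vs \<and>
          length vs = length (concat [[w, z]]) + card T + card A"
        using T(2) lenP P(1) Nil
        by (intro fragments_cycle[of R N A "[[w, z]]" T] fin(1) disj hub ne) simp_all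
      moreover have "length (concat [[w, z]]) + card T + card A = length P"
        using T(2) lenP Nil \<open>0 < card A\<close> \<open>card S = Suc (card A)\<close> by simp
      ultimately show ?thesis by auto
    next
      case (Cons Q Qs')
      with Qs1 have Qs: "Qs = [Q]" by simp
      have cS: "card S = card A" using num Qs by simp
      have F2: "2 \<le> card ?F" and cN: "card N = card S + 2"
        using le card Qs cS by auto
      have Q: "2 \<le> length Q" "successively R Q" "hd Q \<in> N" "last Q \<in> N" "distinct Q"
          "A \<inter> set Q = {}" "S \<inter> set Q = {}"
        using frag Qs by (auto simp: fragments_def)
      have Qne: "Q \<noteq> []" "hd Q \<in> set Q" "last Q \<in> set Q" using Q(1) by (cases Q; auto)+
      have NE: "N = S \<union> {hd Q, last Q}"
        using card_subset_eq[OF fin(2) EN] cE cN Qs by simp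
      have two: "\<exists>e\<in>X. e \<noteq> d" if "2 \<le> card X" for X :: "'a set set" and d
      proof (rule ccontr)
        assume "\<not> (\<exists>e\<in>X. e \<noteq> d)"
        then have "X \<subseteq> {d}" by blast
        then have "card X \<le> card {d}" by (rule card_mono[rotated]) simp
        with that show False by simp
      qed
      have "\<exists>e\<in>?F. e \<noteq> {hd Q, last Q}" by (rule two[OF F2])
      then obtain w' z' where wz': "R w' z'" "w' \<in> N" "z' \<in> N" "{w', z'} \<noteq> {hd Q, last Q}"
        by blast
      have "w' \<noteq> z'" using wz' irrefl by auto
      then have "w' \<in> S \<or> z' \<in> S" using wz'(2-4) unfolding NE by auto
      then obtain w z where wz: "R w z" "R z w" "w \<in> S" "z \<in> N"
        using wz'(1-3) sym[OF wz'(1)] by blast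
      have "w \<noteq> z" using wz irrefl by auto
      have wQ: "w \<notin> set Q" "w \<notin> A" using wz(3) Q(7) disj fS(2) by blast+
      \<comment> \<open>The edge \<open>wz\<close> joins the fragment \<open>[w]\<close> to the one that has \<open>z\<close> as an end.\<close>
      have "\<exists>Qs2 T. fragments R N A Qs2 T \<and> length Qs2 + card T = card A \<and>
              length (concat Qs2) + card T = length Q + card S"
      proof -
        consider "z = last Q" | "z = hd Q" | "z \<in> S" using wz(4) unfolding NE by auto
        then show ?thesis
        proof cases
          case 1
          have "fragments R N A [Q @ [w]] (S - {w})"
            using wz Q wQ Qne fS 1 by (auto simp: fragments_def successively_append_iff)
          then show ?thesis using wz(3) fS cS card_Suc_Diff1[OF fS(1) wz(3)]
            by (intro exI[of _ "[Q @ [w]]"] exI[of _ "S - {w}"]) auto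
        next
          case 2
          have "fragments R N A [w # Q] (S - {w})"
            using wz Q wQ Qne fS 2 by (auto simp: fragments_def successively_Cons)
          then show ?thesis using wz(3) fS cS card_Suc_Diff1[OF fS(1) wz(3)]
            by (intro exI[of _ "[w # Q]"] exI[of _ "S - {w}"]) auto
        next
          case 3
          have "fragments R N A [Q, [w, z]] (S - {w, z})"
            using wz Q wQ Qne fS 3 \<open>w \<noteq> z\<close> disj by (auto simp: fragments_def)
          moreover have "card {w, z} \<le> card S"
            by (rule card_mono) (use wz 3 fS in auto)
          then have "card (S - {w, z}) + 2 = card S"
            using wz 3 fS \<open>w \<noteq> z\<close> by (simp add: card_Diff_subset)
          ultimately show ?thesis using cS
            by (intro exI[of _ "[Q, [w, z]]"] exI[of _ "S - {w, z}"]) auto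
        qed
      qed
      then obtain Qs2 T where "fragments R N A Qs2 T" "length Qs2 + card T = card A"
          "length (concat Qs2) + card T = length Q + card S" by blast
      moreover from this have "length (concat Qs2) + card T + card A = length P"
        using lenP Qs by simp
      ultimately have "\<exists>vs. vertex_cycle R vs \<and> length vs = length P"
        using fragments_cycle[of R N A Qs2 T] fin(1) disj hub ne P(1) by simp
      then show ?thesis by auto
    qed
  qed
qed

section \<open>Circumference\<close>

abbreviation adj :: "'a pair_pre_digraph \<Rightarrow> 'a \<Rightarrow> 'a \<Rightarrow> bool" where
  "adj G x y \<equiv> (x, y) \<in> parcs G"

text \<open>The vertex list of a closed arc walk is read off at the heads of its arcs; the starting vertex
  \<open>u\<close> is kept separate, since it equals the last vertex of the list.\<close>

lemma successively_iff_arc_walk: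
  "(\<exists>p. pcas u p (last (u # vs)) \<and> set p \<subseteq> parcs G \<and> map snd p = vs) \<longleftrightarrow>
   successively (adj G) (u # vs)"
proof (induction vs arbitrary: u)
  case (Cons v vs)
  show ?case (is "?L \<longleftrightarrow> ?R")
  proof
    assume ?L
    then obtain p where p: "pcas u p (last (u # v # vs))" "set p \<subseteq> parcs G" "map snd p = v # vs"
      by (elim exE conjE)
    then obtain q where "p = (u, v) # q" "map snd q = vs" by (cases p) auto
    with p show ?R using Cons.IH[of v] by (auto simp: successively_Cons)
  next
    assume R: ?R
    then obtain p where "pcas v p (last (v # vs))" "set p \<subseteq> parcs G" "map snd p = vs"
      using Cons.IH[of v] by auto
    with R have "pcas u ((u, v) # p) (last (u # v # vs)) \<and> set ((u, v) # p) \<subseteq> parcs G \<and>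
        map snd ((u, v) # p) = v # vs"
      by simp
    then show ?L by (rule exI)
  qed
qed auto

lemma vertex_cycle_iff_undirected_cycle:
  assumes "pair_graph G"
  shows "(\<exists>p. undirected_cycle G p \<and> length p = k) \<longleftrightarrow>
         (\<exists>vs. vertex_cycle (adj G) vs \<and> length vs = k)"
proof -
  interpret pair_graph G by fact
  have verts: "pawalk_verts u p = u # map snd p" if "pcas u p v" for u v :: 'a and p
    using that by (induction p arbitrary: u) auto
  have last: "v = last (u # map snd p)" if "pcas u p v" for u v :: 'a and p
    using that by (induction p arbitrary: u) auto
  show ?thesis
  proof
    assume "\<exists>p. undirected_cycle G p \<and> length p = k"
    then obtain p u where p: "pcas u p u" "set p \<subseteq> parcs G" "distinct (tl (pawalk_verts u p))"
        "3 \<le> length p" "length p = k"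
      by (auto simp: undirected_cycle_def cycle_def awalk_def)
    then have "distinct (map snd p)" "last (u # map snd p) = u"
      using verts last by fastforce+
    moreover have "successively (adj G) (u # map snd p)"
      using p(1,2) last[OF p(1)] by (subst successively_iff_arc_walk[symmetric]) auto
    ultimately show "\<exists>vs. vertex_cycle (adj G) vs \<and> length vs = k"
      using p(4,5) by (intro exI[of _ "map snd p"])
        (auto simp: vertex_cycle_def successively_Cons split: if_splits)
  next
    assume "\<exists>vs. vertex_cycle (adj G) vs \<and> length vs = k"
    then obtain vs where vs: "vertex_cycle (adj G) vs" "length vs = k" by blast
    let ?u = "last vs"
    have ne: "vs \<noteq> []" using vs by (auto simp: vertex_cycle_def)
    have "successively (adj G) (?u # vs)"
      using vs by (auto simp: vertex_cycle_def successively_Cons)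
    then obtain p where p: "pcas ?u p (last (?u # vs))" "set p \<subseteq> parcs G" "map snd p = vs"
      unfolding successively_iff_arc_walk[symmetric] by blast
    have "?u \<in> pverts G" using vs by (auto simp: vertex_cycle_def intro: in_arcsD1)
    moreover have "length p = k" using p(3) vs(2) by auto
    moreover have "pawalk_verts ?u p = ?u # vs" using verts[OF p(1)] p(3) by simp
    ultimately have "undirected_cycle G p"
      using p vs ne by (auto simp: undirected_cycle_def cycle_def awalk_def vertex_cycle_def)
    with \<open>length p = k\<close> show "\<exists>p. undirected_cycle G p \<and> length p = k" by blast
  qed
qed

lemma vertex_cycle_subset_verts:
  assumes "pair_graph G" "vertex_cycle (adj G) vs"
  shows "set vs \<subseteq> pverts G"
proof
  interpret pair_graph G by fact
  fix x assume "x \<in> set vs"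
  then obtain xs ys where spl: "vs = xs @ x # ys" by (auto dest: split_list)
  then have "vertex_cycle (adj G) (x # ys @ xs)"
    using assms(2) vertex_cycle_rotate[of "adj G" xs "x # ys"] by simp
  then have "adj G (last (x # ys @ xs)) x" by (simp add: vertex_cycle_def)
  then show "x \<in> pverts G" by (rule in_arcsD2)
qed

lemma circumference_conv_vertex_cycle:
  assumes "pair_graph G"
  shows vertex_cycle_le_circumference:
      "vertex_cycle (adj G) vs \<Longrightarrow> length vs \<le> circumference G" (is "_ \<Longrightarrow> ?ub")
    and circumference_attained:
      "circumference G \<noteq> 0 \<Longrightarrow> \<exists>vs. vertex_cycle (adj G) vs \<and> length vs = circumference G"
        (is "_ \<Longrightarrow> ?att")
proof -
  interpret pair_graph G by fact
  let ?L = "{length p | p. undirected_cycle G p}"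
  have L: "?L = {length vs | vs. vertex_cycle (adj G) vs}"
  proof (rule set_eqI)
    show "k \<in> ?L \<longleftrightarrow> k \<in> {length vs | vs. vertex_cycle (adj G) vs}" for k
      using vertex_cycle_iff_undirected_cycle[OF assms, of k] by (simp add: conj_commute eq_commute)
  qed
  have "length vs \<le> card (pverts G)" if "vertex_cycle (adj G) vs" for vs
    using card_mono[OF pair_finite_verts vertex_cycle_subset_verts[OF assms that]] that
    by (simp add: vertex_cycle_def distinct_card)
  then have fin: "finite ?L" unfolding L by (auto intro: finite_subset[of _ "{..card (pverts G)}"])
  show ?ub if "vertex_cycle (adj G) vs"
  proof -
    have "length vs \<in> ?L" using that L by blast
    then show ?thesis using fin by (auto simp: circumference_def intro!: Max_ge)
  qed
  show ?att if "circumference G \<noteq> 0"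
  proof -
    have ex: "\<exists>p. undirected_cycle G p" using that by (auto simp: circumference_def split: if_splits)
    then have "circumference G = Max ?L" by (simp add: circumference_def)
    also have "\<dots> \<in> ?L" using ex fin by (intro Max_in) auto
    finally show ?thesis unfolding L by auto
  qed
qed

section \<open>Adding an edge next to an eligible vertex\<close>

definition add_edge :: "'a pair_pre_digraph \<Rightarrow> 'a \<Rightarrow> 'a \<Rightarrow> 'a pair_pre_digraph" where
  "add_edge G u v = G\<lparr>parcs := parcs G \<union> {(u, v), (v, u)}\<rparr>"

lemma add_edge_simps [simp]:
  "pverts (add_edge G u v) = pverts G"
  "parcs (add_edge G u v) = parcs G \<union> {(u, v), (v, u)}"
  by (simp_all add: add_edge_def)

lemma pair_graph_add_edge:
  assumes "pair_graph G" "u \<in> pverts G" "v \<in> pverts G" "u \<noteq> v"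
  shows "pair_graph (add_edge G u v)"
proof -
  interpret pair_graph G by fact
  show ?thesis
    using assms(2-4) pair_finite_verts pair_finite_arcs
    by unfold_locales
      (auto simp: symmetric_def sym_def intro: in_arcsD1 in_arcsD2 arcs_symmetric dest: no_loops')
qed

lemma nbhd_class_twins:
  assumes "pair_graph G" "x \<in> pverts G"
  defines "A \<equiv> nbhd_class G x" and "N \<equiv> nbhd_set G (nbhd_class G x)"
  shows "x \<in> A" "A \<inter> N = {}" "A \<union> N = closed_nbhd G x" "A \<union> N \<subseteq> pverts G"
    and "\<And>y z. y \<in> A \<Longrightarrow> adj G y z \<longleftrightarrow> z \<in> A \<union> N \<and> z \<noteq> y"
proof -
  interpret pair_graph G by fact
  show xA: "x \<in> A" using assms(2) by (simp add: A_def nbhd_class_def)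
  show "A \<inter> N = {}" by (auto simp: A_def N_def nbhd_set_def)
  have eq: "closed_nbhd G y = closed_nbhd G x" if "y \<in> A" for y
    using that by (auto simp: A_def nbhd_class_def)
  have "y \<in> closed_nbhd G y" for y by (simp add: closed_nbhd_def)
  with eq have "A \<subseteq> closed_nbhd G x" by blast
  moreover have "closed_nbhd_set G A = closed_nbhd G x"
    unfolding closed_nbhd_set_def using eq xA by blast
  ultimately show AN: "A \<union> N = closed_nbhd G x" by (auto simp: N_def A_def nbhd_set_def)
  show "A \<union> N \<subseteq> pverts G"
    unfolding AN using assms(2) by (auto simp: closed_nbhd_def nbhd_def intro: in_arcsD2)
  show "adj G y z \<longleftrightarrow> z \<in> A \<union> N \<and> z \<noteq> y" if "y \<in> A" for y z
    unfolding AN eq[OF that, symmetric] by (auto simp: closed_nbhd_def nbhd_def dest: no_loops')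
qed

text \<open>A longest cycle of the larger graph either avoids the new edge or leaves a path between two
  neighbours of the class of \<open>x\<close>, which eligibility allows to be closed up without that edge.\<close>

lemma circumference_add_edge:
  assumes G: "pair_graph G" and elig: "N2_eligible G x"
    and uv: "u \<in> nbhd_set G (nbhd_class G x)" "v \<in> nbhd_set G (nbhd_class G x)" "u \<noteq> v"
  shows "circumference (add_edge G u v) = circumference G"
proof (rule antisym)
  interpret pair_graph G by fact
  let ?A = "nbhd_class G x" and ?N = "nbhd_set G (nbhd_class G x)" and ?H = "add_edge G u v"
  have x: "x \<in> pverts G" using elig by (simp add: N2_eligible_def)
  note twins = nbhd_class_twins[OF G x]
  have H: "pair_graph ?H" using pair_graph_add_edge[OF G] uv twins(4) by auto
  have fin: "finite ?A" "finite ?N"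
    using twins(4) pair_finite_verts finite_subset by (metis le_sup_iff)+
  have card: "card ?N \<le> card ?A + min (card {{x, y} | x y. adj G x y \<and> x \<in> ?N \<and> y \<in> ?N}) 2"
    using elig by (simp add: N2_eligible_def chi2_def sigma_def edges_within_def)
  show "circumference ?H \<le> circumference G"
  proof (cases "circumference ?H = 0")
    case False
    then obtain vs where vs: "vertex_cycle (adj ?H) vs" "length vs = circumference ?H"
      using circumference_attained[OF H] by blast
    have "\<exists>ws. vertex_cycle (adj G) ws \<and> length vs \<le> length ws"
    proof (cases "vertex_cycle (adj G) vs")
      case False
      obtain P where P: "length P = length vs" "distinct P" "successively (adj G) P"
          "{hd P, last P} = {u, v}"
        by (rule vertex_cycle_extra_edge[OF vs(1) _ False, of u v]) auto
      have "{hd P, last P} \<subseteq> ?N" unfolding P(4) using uv by simp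
      moreover have "3 \<le> length P" using P(1) vs(1) by (simp add: vertex_cycle_def)
      ultimately have "\<exists>ws. vertex_cycle (adj G) ws \<and> length P \<le> length ws"
        using P(2,3) card fin twins(1,2,5)
        by (intro twin_path_to_cycle[of "adj G" ?A ?N P])
          (auto dest: arcs_symmetric no_loops')
      then show ?thesis using P(1) by simp
    qed blast
    then show ?thesis using vertex_cycle_le_circumference[OF G] vs(2) by fastforce
  qed simp
  show "circumference G \<le> circumference ?H"
  proof (cases "circumference G = 0")
    case False
    then obtain vs where vs: "vertex_cycle (adj G) vs" "length vs = circumference G"
      using circumference_attained[OF G] by blast
    then have "vertex_cycle (adj ?H) vs"
      by (auto simp: vertex_cycle_def intro: successively_mono)
    then show ?thesis using vertex_cycle_le_circumference[OF H] vs(2) by fastforce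
  qed simp
qed

text \<open>The two non-adjacent vertices witnessing that \<open>x\<close> is not simplicial lie outside the class of
  \<open>x\<close>, because a vertex of the class is adjacent to the whole closed neighbourhood.\<close>

lemma N2_eligible_obtain_nonadjacent:
  assumes G: "pair_graph G" and elig: "N2_eligible G x"
  obtains u v where "u \<in> nbhd_set G (nbhd_class G x)" "v \<in> nbhd_set G (nbhd_class G x)"
    "u \<noteq> v" "\<not> adj G u v"
proof -
  interpret pair_graph G by fact
  have x: "x \<in> pverts G" using elig by (simp add: N2_eligible_def)
  note twins = nbhd_class_twins[OF G x]
  have "\<not> clique G (closed_nbhd G x)" using elig by (simp add: N2_eligible_def simplicial_def)
  then obtain u v where uv: "u \<in> closed_nbhd G x" "v \<in> closed_nbhd G x" "u \<noteq> v" "\<not> adj G u v"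
    using twins(3,4) by (auto simp: clique_def)
  moreover have "\<not> adj G v u" using uv(4) arcs_symmetric by blast
  ultimately show ?thesis using twins(5) that unfolding twins(3)[symmetric] by blast
qed

theorem theorem17:
  fixes G :: "'a pair_pre_digraph" and \<rho> :: "'a set \<Rightarrow> 'a"
  assumes "pair_graph G"
    and "connected (with_proj G)"
    and "choice_function (pverts G) \<rho>"
  shows "\<exists>cl :: 'a pair_pre_digraph.
           pair_graph cl \<and> connected (with_proj cl) \<and>
           (\<forall>x\<in>pverts cl. \<not> N2_eligible cl x) \<and>
           spanning (with_proj G) (with_proj cl) \<and>
           circumference cl = circumference G"
proof -
  interpret G: pair_graph G by fact
  define good where "good H \<longleftrightarrow> pair_graph H \<and> pverts H = pverts G \<and> parcs G \<subseteq> parcs H \<and>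
    circumference H = circumference G" for H :: "'a pair_pre_digraph"
  have "good G" using assms(1) by (simp add: good_def)
  moreover have "\<forall>H. good H \<longrightarrow> card (parcs H) < Suc (card (pverts G \<times> pverts G))"
  proof (intro allI impI le_imp_less_Suc card_mono)
    fix H assume "good H"
    then interpret H: pair_graph H by (simp add: good_def)
    show "parcs H \<subseteq> pverts G \<times> pverts G"
      using \<open>good H\<close> H.in_arcsD1 H.in_arcsD2 by (auto simp: good_def)
  qed (simp add: G.pair_finite_verts)
  ultimately have "\<exists>H. good H \<and> (\<forall>K. good K \<longrightarrow> card (parcs K) \<le> card (parcs H))"
    by (rule ex_has_greatest_nat)
  then obtain H where H: "good H" and max: "\<And>K. good K \<Longrightarrow> card (parcs K) \<le> card (parcs H)"
    by (elim exE conjE) simp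
  interpret H: pair_graph H using H by (simp add: good_def)
  have "\<not> N2_eligible H x" for x
  proof
    assume elig: "N2_eligible H x"
    obtain u v where uv: "u \<in> nbhd_set H (nbhd_class H x)" "v \<in> nbhd_set H (nbhd_class H x)"
        "u \<noteq> v" "\<not> adj H u v"
      by (rule N2_eligible_obtain_nonadjacent[OF H.pair_graph elig])
    have "x \<in> pverts H" using elig by (simp add: N2_eligible_def)
    then have "u \<in> pverts H" "v \<in> pverts H"
      using uv nbhd_class_twins(4)[OF H.pair_graph] by blast+
    then have "good (add_edge H u v)"
      using H uv pair_graph_add_edge[OF H.pair_graph]
        circumference_add_edge[OF H.pair_graph elig uv(1-3)]
      by (auto simp: good_def)
    then have "card (parcs (add_edge H u v)) \<le> card (parcs H)" by (rule max)
    moreover have "parcs H \<subset> parcs (add_edge H u v)" using uv(4) by auto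
    then have "card (parcs H) < card (parcs (add_edge H u v))"
      by (intro psubset_card_mono) (simp_all add: H.pair_finite_arcs)
    ultimately show False by simp
  qed
  moreover have sp: "spanning (with_proj G) (with_proj H)"
    using H G.wf_digraph_axioms H.wf_digraph_axioms
    by (auto simp: spanning_def subgraph_def compatible_def good_def)
  moreover have "connected (with_proj H)"
    by (rule H.connected_spanning_imp_connected[OF sp assms(2)])
  ultimately show ?thesis using H by (auto simp: good_def)
qed

end
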